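(* Let $H:\mathbb{R}^d\times\mathbb{R}^d\to\mathbb{R}$ be a smooth Hamiltonian. For any fixed parameter $\lambda\in\mathbb{R}$, the one-step scheme $\Phi_h^\lambda:(p_n,q_n)\mapsto(p_{n+1},q_{n+1})$ defined by $$p_{n+1}=p_n-hH_q\big(\lambda p_{n+1}+(1-\lambda)p_n,\ \lambda q_n+(1-\lambda)q_{n+1}\big),\qquad q_{n+1}=q_n+hH_p\big(\lambda p_{n+1}+(1-\lambda)p_n,\ \lambda q_n+(1-\lambda)q_{n+1}\big)$$ is symplectic.
   Context: $H_p,H_q$ denote the column vectors of partial derivatives of $H=H(p,q)$ with respect to its first and second argument. The step size $h$ is small enough that the implicit equations locally define a smooth map $(p_n,q_n)\mapsto(p_{n+1},q_{n+1})$ close to the identity. A one-step scheme is symplectic if the Jacobian $M=\partial(p_{n+1},q_{n+1})/\partial(p_n,q_n)$ satisfies $M^TJM=J$, where $J=\begin{pmatrix}0&I_d\\-I_d&0\end{pmatrix}$. *)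

theory Defs
  imports "HOL-Analysis.Analysis"
begin

text \<open>\<open>C\<^sup>k\<close> maps on an open set: the values of the Frechet derivative at every fixed vector
  are \<open>C\<^sup>k\<^sup>-\<^sup>1\<close>.  In finite dimensions this is the usual notion.\<close>

fun Ck_on :: "nat \<Rightarrow> ('a::euclidean_space \<Rightarrow> 'b::euclidean_space) \<Rightarrow> 'a set \<Rightarrow> bool" where
  "Ck_on 0 f S \<longleftrightarrow> continuous_on S f"
| "Ck_on (Suc k) f S \<longleftrightarrow>
     (\<forall>x\<in>S. f differentiable (at x)) \<and>
     (\<forall>v. Ck_on k (\<lambda>x. frechet_derivative f (at x) v) S)"

definition smooth_on :: "('a::euclidean_space \<Rightarrow> 'b::euclidean_space) \<Rightarrow> 'a set \<Rightarrow> bool" where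
  "smooth_on f S \<longleftrightarrow> (\<forall>k. Ck_on k f S)"

type_synonym 'd phase = "(real ^ 'd) \<times> (real ^ 'd)"

definition grad_p :: "('d::finite phase \<Rightarrow> real) \<Rightarrow> real ^ 'd \<Rightarrow> real ^ 'd \<Rightarrow> real ^ 'd" where
  "grad_p H p q = (\<chi> i. deriv (\<lambda>t. H (p + t *\<^sub>R axis i 1, q)) 0)"

definition grad_q :: "('d::finite phase \<Rightarrow> real) \<Rightarrow> real ^ 'd \<Rightarrow> real ^ 'd \<Rightarrow> real ^ 'd" where
  "grad_q H p q = (\<chi> i. deriv (\<lambda>t. H (p, q + t *\<^sub>R axis i 1)) 0)"

definition lambda_step ::
    "('d::finite phase \<Rightarrow> real) \<Rightarrow> real \<Rightarrow> real \<Rightarrow> 'd phase \<Rightarrow> 'd phase \<Rightarrow> bool" where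
  "lambda_step H lam h = (\<lambda>(p, q) (p', q').
     p' = p - h *\<^sub>R grad_q H (lam *\<^sub>R p' + (1 - lam) *\<^sub>R p) (lam *\<^sub>R q + (1 - lam) *\<^sub>R q') \<and>
     q' = q + h *\<^sub>R grad_p H (lam *\<^sub>R p' + (1 - lam) *\<^sub>R p) (lam *\<^sub>R q + (1 - lam) *\<^sub>R q'))"

text \<open>A smooth map on an open set \<open>U\<close> given by the implicit equations.  Smallness of \<open>h\<close>
  and closeness to the identity serve to guarantee that such a map exists and to single out
  one solution branch; here every step size and every smooth solution branch is admitted,
  in particular the one close to the identity.\<close>

definition lambda_scheme ::
    "('d::finite phase \<Rightarrow> real) \<Rightarrow> real \<Rightarrow> real \<Rightarrow> 'd phase set \<Rightarrow> ('d phase \<Rightarrow> 'd phase) \<Rightarrow> bool" where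
  "lambda_scheme H lam h U \<Phi> \<longleftrightarrow>
     open U \<and> smooth_on \<Phi> U \<and> (\<forall>z\<in>U. lambda_step H lam h z (\<Phi> z))"

text \<open>\<open>'d + 'd\<close> indexes the \<open>2d\<close> coordinates: \<open>Inl\<close> for \<open>p\<close>, \<open>Inr\<close> for \<open>q\<close>.\<close>

definition stack :: "'d::finite phase \<Rightarrow> real ^ ('d + 'd)" where
  "stack z = (\<chi> k. case k of Inl i \<Rightarrow> fst z $ i | Inr i \<Rightarrow> snd z $ i)"

definition unstack :: "real ^ ('d + 'd) \<Rightarrow> 'd::finite phase" where
  "unstack x = ((\<chi> i. x $ Inl i), (\<chi> i. x $ Inr i))"

definition block_matrix ::
    "real ^ 'd ^ 'd \<Rightarrow> real ^ 'd ^ 'd \<Rightarrow> real ^ 'd ^ 'd \<Rightarrow> real ^ 'd ^ 'd \<Rightarrow>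
     real ^ ('d + 'd) ^ ('d::finite + 'd)" where
  "block_matrix A B C D = (\<chi> k l.
     case k of Inl i \<Rightarrow> (case l of Inl j \<Rightarrow> A $ i $ j | Inr j \<Rightarrow> B $ i $ j)
             | Inr i \<Rightarrow> (case l of Inl j \<Rightarrow> C $ i $ j | Inr j \<Rightarrow> D $ i $ j))"

definition J_matrix :: "real ^ ('d + 'd) ^ ('d::finite + 'd)" where
  "J_matrix = block_matrix 0 (mat 1) (- mat 1) 0"

definition phase_jacobian :: "('d::finite phase \<Rightarrow> 'd phase) \<Rightarrow> 'd phase \<Rightarrow> real ^ ('d + 'd) ^ ('d + 'd)" where
  "phase_jacobian \<Phi> z = jacobian (stack \<circ> \<Phi> \<circ> unstack) (at (stack z))"

definition symplectic_on :: "('d::finite phase \<Rightarrow> 'd phase) \<Rightarrow> 'd phase set \<Rightarrow> bool" where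
  "symplectic_on \<Phi> U \<longleftrightarrow>
     (\<forall>z\<in>U. \<Phi> differentiable (at z) \<and>
       transpose (phase_jacobian \<Phi> z) ** J_matrix ** phase_jacobian \<Phi> z = J_matrix)"

end

theory Submission
  imports Defs
begin

text \<open>Write \<open>\<Delta>p = dp' - dp\<close>, \<open>\<Delta>q = dq' - dq\<close> and let \<open>(P, Q)\<close> be the point at which the gradient is
  evaluated, so that \<open>dP = dp + \<lambda> \<Delta>p\<close> and \<open>dQ = dq' - \<lambda> \<Delta>q\<close>. Then
  \<open>dp' \<and> dq' - dp \<and> dq = \<Delta>p \<and> dq' + dp \<and> \<Delta>q = \<Delta>p \<and> dQ + dP \<and> \<Delta>q\<close>, the terms in \<open>\<lambda>\<close>
  cancelling. Differentiating the implicit equations expresses \<open>\<Delta>p\<close> and \<open>\<Delta>q\<close> through the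
  Hessian of \<open>H\<close> applied to \<open>(dP, dQ)\<close>, and the right hand side vanishes because the Hessian
  is symmetric. The implicit equations never have to be solved for \<open>dp'\<close> and \<open>dq'\<close>.\<close>

section \<open>Symmetry of second derivatives\<close>

text \<open>Two applications of the one-dimensional mean value theorem: first along \<open>v\<close>
  to the increment of \<open>f\<close> in direction \<open>t *\<^sub>R w\<close>, which yields
  \<open>s\<close>, then along \<open>w\<close> to the directional derivative of \<open>f\<close> in
  direction \<open>v\<close>, which yields \<open>r\<close>.\<close>

lemma second_difference_mean_value:
  fixes f :: "'a::real_normed_vector \<Rightarrow> real"
  assumes df: "\<And>x. f differentiable (at x)"
    and d2f: "\<And>x. (\<lambda>y. frechet_derivative f (at y) v) differentiable (at x)"
    and t: "t > 0"
  shows "\<exists>s r. 0 < s \<and> s < t \<and> 0 < r \<and> r < t \<and>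
    f (x + t *\<^sub>R v + t *\<^sub>R w) - f (x + t *\<^sub>R v) - f (x + t *\<^sub>R w) + f x
     = t * t * frechet_derivative (\<lambda>y. frechet_derivative f (at y) v)
                 (at (x + s *\<^sub>R v + r *\<^sub>R w)) w"
proof -
  define g where "g = (\<lambda>y. frechet_derivative f (at y) v)"
  have line: "((\<lambda>s. k (a + s *\<^sub>R u)) has_real_derivative
      frechet_derivative k (at (a + s *\<^sub>R u)) u) (at s)"
    if dk: "\<And>x. k differentiable (at x)" for k :: "'a \<Rightarrow> real" and a u s
  proof -
    have fd: "(k has_derivative frechet_derivative k (at (a + s *\<^sub>R u))) (at (a + s *\<^sub>R u))"
      using dk frechet_derivative_works by blast
    have "((\<lambda>s. a + s *\<^sub>R u) has_derivative (\<lambda>d. d *\<^sub>R u)) (at s)"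
      by (auto intro!: derivative_eq_intros)
    from has_derivative_compose[OF this fd]
    have "((\<lambda>s. k (a + s *\<^sub>R u)) has_derivative
        (\<lambda>d. frechet_derivative k (at (a + s *\<^sub>R u)) (d *\<^sub>R u))) (at s)" .
    moreover have "frechet_derivative k (at (a + s *\<^sub>R u)) (d *\<^sub>R u)
        = frechet_derivative k (at (a + s *\<^sub>R u)) u * d" for d
      using linear_cmul[OF has_derivative_linear[OF fd]] by simp
    ultimately show ?thesis
      by (simp add: has_field_derivative_def)
  qed
  have df': "((\<lambda>s. f (x + t *\<^sub>R w + s *\<^sub>R v) - f (x + s *\<^sub>R v)) has_real_derivative
      g (x + t *\<^sub>R w + s *\<^sub>R v) - g (x + s *\<^sub>R v)) (at s)" for s
    unfolding g_def by (intro DERIV_diff line df)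
  from MVT2[OF t df'] obtain s where s: "0 < s" "s < t"
    and s_eq: "f (x + t *\<^sub>R w + t *\<^sub>R v) - f (x + t *\<^sub>R v) - (f (x + t *\<^sub>R w + 0 *\<^sub>R v) - f (x + 0 *\<^sub>R v))
      = (t - 0) * (g (x + t *\<^sub>R w + s *\<^sub>R v) - g (x + s *\<^sub>R v))"
    by blast
  have dg': "((\<lambda>r. g (x + s *\<^sub>R v + r *\<^sub>R w)) has_real_derivative
      frechet_derivative g (at (x + s *\<^sub>R v + r *\<^sub>R w)) w) (at r)" for r
    using d2f unfolding g_def[symmetric] by (intro line)
  from MVT2[OF t dg'] obtain r where r: "0 < r" "r < t"
    and r_eq: "g (x + s *\<^sub>R v + t *\<^sub>R w) - g (x + s *\<^sub>R v + 0 *\<^sub>R w)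
      = (t - 0) * frechet_derivative g (at (x + s *\<^sub>R v + r *\<^sub>R w)) w"
    by blast
  have "f (x + t *\<^sub>R v + t *\<^sub>R w) - f (x + t *\<^sub>R v) - f (x + t *\<^sub>R w) + f x
     = t * t * frechet_derivative g (at (x + s *\<^sub>R v + r *\<^sub>R w)) w"
  proof -
    have comm: "x + t *\<^sub>R w + s *\<^sub>R v = x + s *\<^sub>R v + t *\<^sub>R w" for s
      by (simp add: ac_simps)
    have "f (x + t *\<^sub>R v + t *\<^sub>R w) - f (x + t *\<^sub>R v) - f (x + t *\<^sub>R w) + f x
        = t * (g (x + s *\<^sub>R v + t *\<^sub>R w) - g (x + s *\<^sub>R v))"
      using s_eq by (simp add: comm[of s] comm[of t])
    then show ?thesis
      using r_eq by simp
  qed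
  then show ?thesis
    using s r unfolding g_def by blast
qed

text \<open>The intermediate points of the mean value form lie within \<open>t\<close> of zero in
  both parameters, so they tend to \<open>x\<close>, and continuity of the second derivative passes
  to the limit.\<close>

lemma second_difference_quotient_tendsto:
  fixes f :: "'a::euclidean_space \<Rightarrow> real"
  assumes C2: "Ck_on 2 f UNIV"
  shows "((\<lambda>t. (f (x + t *\<^sub>R v + t *\<^sub>R w) - f (x + t *\<^sub>R v) - f (x + t *\<^sub>R w) + f x) / (t * t))
    \<longlongrightarrow> frechet_derivative (\<lambda>y. frechet_derivative f (at y) v) (at x) w) (at_right 0)"
proof -
  define K where "K = (\<lambda>y. frechet_derivative (\<lambda>y. frechet_derivative f (at y) v) (at y) w)"
  define F where "F = (\<lambda>t. f (x + t *\<^sub>R v + t *\<^sub>R w) - f (x + t *\<^sub>R v) - f (x + t *\<^sub>R w) + f x)"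
  have df: "\<And>x. f differentiable (at x)"
    and d2f: "\<And>x. (\<lambda>y. frechet_derivative f (at y) v) differentiable (at x)"
    and cont: "continuous_on UNIV K"
    using C2 unfolding K_def by (simp_all add: numeral_2_eq_2)
  \<comment> \<open>The premise \<open>0 < t\<close> sits under the existential so that choice
    yields functions \<open>s\<close> and \<open>r\<close> defined for all \<open>t\<close>.\<close>
  have "\<forall>t. \<exists>s r. 0 < t \<longrightarrow> 0 < s \<and> s < t \<and> 0 < r \<and> r < t \<and>
      F t = t * t * K (x + s *\<^sub>R v + r *\<^sub>R w)"
    using second_difference_mean_value[OF df d2f, of _ x w]
    unfolding F_def K_def by metis
  then obtain s r where sr: "\<And>t. 0 < t \<Longrightarrow> 0 < s t \<and> s t < t \<and> 0 < r t \<and> r t < t \<and>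
      F t = t * t * K (x + s t *\<^sub>R v + r t *\<^sub>R w)"
    by metis
  have pos: "\<forall>\<^sub>F t in at_right 0. (0::real) < t"
    by (simp add: eventually_at_right_less)
  have to0: "((\<lambda>t. t) \<longlongrightarrow> 0) (at_right (0::real))"
    by (rule tendsto_ident_at)
  have "(s \<longlongrightarrow> 0) (at_right 0)" "(r \<longlongrightarrow> 0) (at_right 0)"
    by (rule tendsto_sandwich[OF _ _ tendsto_const to0];
        use pos sr in \<open>auto elim!: eventually_mono intro: less_imp_le\<close>)+
  then have "((\<lambda>t. x + s t *\<^sub>R v + r t *\<^sub>R w) \<longlongrightarrow> x + 0 *\<^sub>R v + 0 *\<^sub>R w) (at_right 0)"
    by (intro tendsto_intros)
  then have "((\<lambda>t. K (x + s t *\<^sub>R v + r t *\<^sub>R w)) \<longlongrightarrow> K x) (at_right 0)"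
    using continuous_on_tendsto_compose[OF cont] by simp
  moreover have "\<forall>\<^sub>F t in at_right 0. K (x + s t *\<^sub>R v + r t *\<^sub>R w) = F t / (t * t)"
    using pos by eventually_elim (use sr in auto)
  ultimately have "((\<lambda>t. F t / (t * t)) \<longlongrightarrow> K x) (at_right 0)"
    by (rule Lim_transform_eventually)
  then show ?thesis
    unfolding F_def K_def .
qed

text \<open>The second difference is unchanged when \<open>v\<close> and \<open>w\<close> are
  swapped, so both iterated derivatives are limits of the same quotient.\<close>

lemma second_frechet_derivative_symmetric:
  fixes f :: "'a::euclidean_space \<Rightarrow> real"
  assumes "Ck_on 2 f UNIV"
  shows "frechet_derivative (\<lambda>y. frechet_derivative f (at y) v) (at x) w
       = frechet_derivative (\<lambda>y. frechet_derivative f (at y) w) (at x) v"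
proof -
  have "((\<lambda>t. (f (x + t *\<^sub>R v + t *\<^sub>R w) - f (x + t *\<^sub>R v) - f (x + t *\<^sub>R w) + f x) / (t * t))
    \<longlongrightarrow> frechet_derivative (\<lambda>y. frechet_derivative f (at y) w) (at x) v) (at_right 0)"
    using second_difference_quotient_tendsto[OF assms, of x w v]
    by (simp add: algebra_simps)
  with second_difference_quotient_tendsto[OF assms, of x v w] show ?thesis
    using tendsto_unique trivial_limit_at_right_real by blast
qed

section \<open>Gradient and Hessian of the Hamiltonian\<close>

text \<open>Links the coordinatewise partial derivatives to the Frechet derivative: each partial is
  its value at a standard basis vector, and linearity does the rest.\<close>

lemma grad_inner:
  fixes H :: "'d::finite phase \<Rightarrow> real"
  assumes "H differentiable (at (p, q))"
  shows "(grad_p H p q, grad_q H p q) \<bullet> u = frechet_derivative H (at (p, q)) u"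
proof -
  let ?L = "frechet_derivative H (at (p, q))"
  have fd: "(H has_derivative ?L) (at (p, q))"
    using assms frechet_derivative_works by blast
  then have lin: "linear ?L"
    by (rule has_derivative_linear)
  have line: "deriv (\<lambda>t. H ((p, q) + t *\<^sub>R b)) 0 = ?L b" for b
  proof -
    have fd0: "(H has_derivative ?L) (at ((p, q) + 0 *\<^sub>R b))"
      using fd by simp
    have "((\<lambda>t::real. (p, q) + t *\<^sub>R b) has_derivative (\<lambda>d. d *\<^sub>R b)) (at 0)"
      by (auto intro!: derivative_eq_intros)
    from has_derivative_compose[OF this fd0]
    have "((\<lambda>t. H ((p, q) + t *\<^sub>R b)) has_derivative (\<lambda>d. ?L (d *\<^sub>R b))) (at 0)" .
    then have "((\<lambda>t. H ((p, q) + t *\<^sub>R b)) has_real_derivative ?L b) (at 0)"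
      using linear_cmul[OF lin] by (simp add: has_field_derivative_def mult_commute_abs)
    then show ?thesis
      by (rule DERIV_imp_deriv)
  qed
  have gp: "grad_p H p q $ i = ?L (axis i 1, 0)" for i
    using line[of "(axis i 1, 0)"] by (simp add: grad_p_def)
  have gq: "grad_q H p q $ i = ?L (0, axis i 1)" for i
    using line[of "(0, axis i 1)"] by (simp add: grad_q_def)
  have "u = (\<Sum>i\<in>UNIV. (fst u $ i) *\<^sub>R (axis i 1, 0)) + (\<Sum>i\<in>UNIV. (snd u $ i) *\<^sub>R (0, axis i 1))"
    by (simp add: prod_eq_iff fst_sum snd_sum basis_expansion flip: scalar_mult_eq_scaleR)
  then have "?L u = ?L ((\<Sum>i\<in>UNIV. (fst u $ i) *\<^sub>R (axis i 1, 0)) + (\<Sum>i\<in>UNIV. (snd u $ i) *\<^sub>R (0, axis i 1)))"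
    by simp
  also have "\<dots> = (\<Sum>i\<in>UNIV. fst u $ i * ?L (axis i 1, 0)) + (\<Sum>i\<in>UNIV. snd u $ i * ?L (0, axis i 1))"
    using lin by (simp add: linear_add linear_sum linear_cmul del: scaleR_Pair)
  also have "\<dots> = (grad_p H p q, grad_q H p q) \<bullet> u"
    by (cases u) (simp add: inner_vec_def gp gq mult.commute)
  finally show ?thesis
    by simp
qed

text \<open>\<open>A\<close> is the Hessian of \<open>H\<close> at \<open>z\<close>, kept as a
  linear map; its self-adjointness is the symmetry of second derivatives.\<close>

lemma grad_has_symmetric_derivative:
  fixes H :: "'d::finite phase \<Rightarrow> real"
  assumes C2: "Ck_on 2 H UNIV"
  obtains A where "((\<lambda>x. (grad_p H (fst x) (snd x), grad_q H (fst x) (snd x))) has_derivative A) (at z)"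
    and "\<And>u v. A u \<bullet> v = u \<bullet> A v"
proof -
  define G where "G = (\<lambda>x. (grad_p H (fst x) (snd x), grad_q H (fst x) (snd x)))"
  have dH: "\<And>x. H differentiable (at x)"
    and d2H: "\<And>x v. (\<lambda>y. frechet_derivative H (at y) v) differentiable (at x)"
    using C2 unfolding numeral_2_eq_2 Ck_on.simps by blast+
  have G_inner: "(\<lambda>x. G x \<bullet> v) = (\<lambda>x. frechet_derivative H (at x) v)" for v
    unfolding G_def using grad_inner dH by fastforce
  then have dGv: "(\<lambda>x. G x \<bullet> v) differentiable (at z)" for v
    using d2H by simp
  \<comment> \<open>The component of \<open>G\<close> along a basis vector is a directional
    derivative of \<open>H\<close>, which is differentiable.\<close>
  have "G differentiable (at z)"
    by (subst differentiable_componentwise_within) (use dGv in blast)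
  then obtain A where A: "(G has_derivative A) (at z)"
    unfolding differentiable_def by blast
  have "A u \<bullet> v = frechet_derivative (\<lambda>x. frechet_derivative H (at x) v) (at z) u" for u v
  proof -
    have "((\<lambda>x. G x \<bullet> v) has_derivative (\<lambda>u. A u \<bullet> v)) (at z)"
      using A by (rule has_derivative_inner_left)
    then show ?thesis
      unfolding G_inner using frechet_derivative_at by metis
  qed
  then have "A u \<bullet> v = u \<bullet> A v" for u v
    using second_frechet_derivative_symmetric[OF C2] by (metis inner_commute)
  with A show thesis
    using that unfolding G_def by blast
qed

section \<open>From pairs to coordinates and matrices\<close>

lemma linear_stack: "linear stack"
  by (rule linearI) (auto simp: stack_def vec_eq_iff split: sum.split)

lemma linear_unstack: "linear unstack"
  by (rule linearI) (auto simp: unstack_def vec_eq_iff)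

lemma unstack_stack [simp]: "unstack (stack z) = z"
  by (simp add: stack_def unstack_def)

lemma stack_unstack [simp]: "stack (unstack x) = x"
  by (auto simp: stack_def unstack_def vec_eq_iff split: sum.split)

lemma sum_UNIV_Plus:
  fixes f :: "'a::finite + 'b::finite \<Rightarrow> 'c::comm_monoid_add"
  shows "(\<Sum>k\<in>UNIV. f k) = (\<Sum>i\<in>UNIV. f (Inl i)) + (\<Sum>i\<in>UNIV. f (Inr i))"
  unfolding UNIV_Plus_UNIV[symmetric] by (subst sum.Plus) (auto simp: comp_def)

lemma stack_inner: "stack u \<bullet> stack v = u \<bullet> v"
  by (simp add: inner_vec_def inner_prod_def sum_UNIV_Plus stack_def)

lemma J_matrix_stack: "J_matrix *v stack (p, q) = stack (q, - p)"
  by (auto simp: vec_eq_iff J_matrix_def block_matrix_def stack_def matrix_vector_mult_def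
      sum_UNIV_Plus mat_def if_distrib if_distribR sum_negf cong: if_cong split: sum.split)

text \<open>Chain rule through the linear maps \<open>stack\<close> and \<open>unstack\<close>;
  every coordinate vector is some \<open>stack u\<close>, so this determines the Jacobian
  completely.\<close>

lemma phase_jacobian_stack:
  assumes "(\<Phi> has_derivative D) (at z)"
  shows "phase_jacobian \<Phi> z *v stack u = stack (D u)"
proof -
  have "(\<Phi> has_derivative D) (at (unstack (stack z)))"
    using assms by simp
  moreover have "(unstack has_derivative unstack) (at (stack z))"
    by (rule linear_imp_has_derivative) (rule linear_unstack)
  ultimately have "((\<lambda>x. \<Phi> (unstack x)) has_derivative (\<lambda>x. D (unstack x))) (at (stack z))"
    by (rule has_derivative_compose[rotated])
  moreover have "(stack has_derivative stack) (at (\<Phi> (unstack (stack z))))"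
    by (rule linear_imp_has_derivative) (rule linear_stack)
  ultimately have d: "((stack \<circ> \<Phi> \<circ> unstack) has_derivative (\<lambda>x. stack (D (unstack x)))) (at (stack z))"
    unfolding comp_def by (rule has_derivative_compose)
  then have "frechet_derivative (stack \<circ> \<Phi> \<circ> unstack) (at (stack z)) = (\<lambda>x. stack (D (unstack x)))"
    by (rule frechet_derivative_at[symmetric])
  then show ?thesis
    using has_derivative_linear[OF d]
    by (simp add: phase_jacobian_def jacobian_def matrix_works)
qed

text \<open>Under \<open>stack\<close>, \<open>J_matrix\<close> represents the bilinear form in
  assumption \<open>D\<close>; a matrix is determined by its bilinear form, so invariance of the
  form is the matrix identity.\<close>

lemma symplectic_matrixI:
  fixes M :: "real ^ ('d::finite + 'd) ^ ('d + 'd)"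
  assumes M: "\<And>u. M *v stack u = stack (D u)"
    and D: "\<And>u v. fst (D u) \<bullet> snd (D v) - snd (D u) \<bullet> fst (D v) = fst u \<bullet> snd v - snd u \<bullet> fst v"
  shows "transpose M ** J_matrix ** M = J_matrix"
proof -
  have J: "stack u \<bullet> (J_matrix *v stack v) = fst u \<bullet> snd v - snd u \<bullet> fst v" for u v :: "'d phase"
    by (cases u; cases v) (simp add: J_matrix_stack stack_inner)
  have "x \<bullet> ((transpose M ** J_matrix ** M) *v y) = x \<bullet> (J_matrix *v y)" for x y
  proof -
    have "x \<bullet> ((transpose M ** J_matrix ** M) *v y) = (M *v x) \<bullet> (J_matrix *v (M *v y))"
      by (metis dot_lmul_matrix matrix_vector_mul_assoc transpose_transpose vector_transpose_matrix)
    also have "\<dots> = x \<bullet> (J_matrix *v y)"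
      using J[of "D (unstack x)" "D (unstack y)"] J[of "unstack x" "unstack y"]
        D[of "unstack x" "unstack y"] M[of "unstack x"] M[of "unstack y"] by simp
    finally show ?thesis .
  qed
  then show ?thesis
    by (metis matrix_eq vector_eq_ldot)
qed

section \<open>The linearised scheme and the main result\<close>

text \<open>The two sides differ by exactly \<open>h * (X u \<bullet> b - a \<bullet> X v)\<close>,
  where \<open>a\<close> and \<open>b\<close> are the Hessian images of \<open>X u\<close> and
  \<open>X v\<close>. The terms in \<open>h * h\<close> match because the weights \<open>lam\<close>
  and \<open>1 - lam\<close> add up to one.\<close>

lemma linearised_step_preserves_symplectic_form:
  fixes A D X :: "'d::finite phase \<Rightarrow> 'd phase"
  assumes A: "\<And>u v. A u \<bullet> v = u \<bullet> A v"
    and X: "\<And>u. X u = (lam *\<^sub>R fst (D u) + (1 - lam) *\<^sub>R fst u,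
                     lam *\<^sub>R snd u + (1 - lam) *\<^sub>R snd (D u))"
    and D: "\<And>u. D u = (fst u - h *\<^sub>R snd (A (X u)), snd u + h *\<^sub>R fst (A (X u)))"
  shows "fst (D u) \<bullet> snd (D v) - snd (D u) \<bullet> fst (D v) = fst u \<bullet> snd v - snd u \<bullet> fst v"
proof -
  define a b where "a = A (X u)" and "b = A (X v)"
  \<comment> \<open>Eliminates \<open>D\<close> from \<open>X\<close>, leaving only \<open>w\<close>
    and the Hessian image \<open>c\<close>, which is treated as an independent vector.\<close>
  have X': "X w = (fst w - (lam * h) *\<^sub>R snd c, snd w + ((1 - lam) * h) *\<^sub>R fst c)"
    if "c = A (X w)" for w c
  proof -
    have "D w = (fst w - h *\<^sub>R snd c, snd w + h *\<^sub>R fst c)"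
      using D[of w] that by simp
    then show ?thesis
      unfolding X[of w] by (simp add: algebra_simps)
  qed
  have "h * (a \<bullet> X v) = h * (X u \<bullet> b)"
    using A unfolding a_def b_def by simp
  then show ?thesis
    unfolding D[of u] D[of v] a_def[symmetric] b_def[symmetric]
    unfolding X'[OF a_def] X'[OF b_def]
    by (simp add: inner_prod_def inner_simps algebra_simps inner_commute)
qed

theorem mainTheorem4:
  fixes H :: "(real ^ 'd::finite) \<times> (real ^ 'd) \<Rightarrow> real"
    and \<Phi> :: "(real ^ 'd) \<times> (real ^ 'd) \<Rightarrow> (real ^ 'd) \<times> (real ^ 'd)"
    and U :: "((real ^ 'd) \<times> (real ^ 'd)) set"
    and lam h :: real
  assumes "smooth_on H UNIV"
    and "lambda_scheme H lam h U \<Phi>"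
  shows "symplectic_on \<Phi> U"
  unfolding symplectic_on_def
proof (intro ballI conjI)
  fix z assume z: "z \<in> U"
  have U: "open U" and step: "\<And>x. x \<in> U \<Longrightarrow> lambda_step H lam h x (\<Phi> x)"
    and smooth: "smooth_on \<Phi> U"
    using assms(2) by (auto simp: lambda_scheme_def)
  from smooth have "Ck_on (Suc 0) \<Phi> U"
    unfolding smooth_on_def by blast
  then show "\<Phi> differentiable (at z)"
    using z by simp
  then obtain D where D: "(\<Phi> has_derivative D) (at z)"
    unfolding differentiable_def by blast
  define G where "G = (\<lambda>x. (grad_p H (fst x) (snd x), grad_q H (fst x) (snd x)))"
  \<comment> \<open>\<open>m x\<close> is the point at which the scheme evaluates the gradient, and
    \<open>X\<close> is the derivative of \<open>m\<close> at \<open>z\<close>.\<close>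
  define m where "m = (\<lambda>x. (lam *\<^sub>R fst (\<Phi> x) + (1 - lam) *\<^sub>R fst x, lam *\<^sub>R snd x + (1 - lam) *\<^sub>R snd (\<Phi> x)))"
  define X where "X = (\<lambda>u. (lam *\<^sub>R fst (D u) + (1 - lam) *\<^sub>R fst u, lam *\<^sub>R snd u + (1 - lam) *\<^sub>R snd (D u)))"
  have "Ck_on 2 H UNIV"
    using assms(1) unfolding smooth_on_def by blast
  then obtain A where A: "(G has_derivative A) (at (m z))" and sym: "\<And>u v. A u \<bullet> v = u \<bullet> A v"
    by (rule grad_has_symmetric_derivative[of H "m z", folded G_def]) blast
  have "(m has_derivative X) (at z)"
    unfolding m_def X_def
    by (intro has_derivative_Pair has_derivative_add has_derivative_scaleR_right
        has_derivative_fst has_derivative_snd D has_derivative_ident)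
  then have GX: "((\<lambda>x. G (m x)) has_derivative (\<lambda>u. A (X u))) (at z)"
    using A by (rule has_derivative_compose)
  have \<Phi>_eq: "(fst x - h *\<^sub>R snd (G (m x)), snd x + h *\<^sub>R fst (G (m x))) = \<Phi> x" if "x \<in> U" for x
    using step[OF that] by (auto simp: lambda_step_def G_def m_def split: prod.splits)
  have "((\<lambda>x. (fst x - h *\<^sub>R snd (G (m x)), snd x + h *\<^sub>R fst (G (m x)))) has_derivative
      (\<lambda>u. (fst u - h *\<^sub>R snd (A (X u)), snd u + h *\<^sub>R fst (A (X u))))) (at z)"
    by (intro has_derivative_Pair has_derivative_add has_derivative_diff has_derivative_scaleR_right
        has_derivative_fst has_derivative_snd GX has_derivative_ident)
  \<comment> \<open>The implicit equations hold only on \<open>U\<close>; as \<open>U\<close> is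
    open, they may still be differentiated at \<open>z\<close>.\<close>
  then have "(\<Phi> has_derivative
      (\<lambda>u. (fst u - h *\<^sub>R snd (A (X u)), snd u + h *\<^sub>R fst (A (X u))))) (at z)"
    using U z \<Phi>_eq by (rule has_derivative_transform_within_open)
  \<comment> \<open>Uniqueness of the derivative gives an implicit linear equation for
    \<open>D\<close>, since \<open>X\<close> itself contains \<open>D\<close>.\<close>
  then have "D = (\<lambda>u. (fst u - h *\<^sub>R snd (A (X u)), snd u + h *\<^sub>R fst (A (X u))))"
    using D has_derivative_unique by blast
  then have "fst (D u) \<bullet> snd (D v) - snd (D u) \<bullet> fst (D v) = fst u \<bullet> snd v - snd u \<bullet> fst v" for u v
    by (intro linearised_step_preserves_symplectic_form[OF sym, of X lam D h])
      (simp add: X_def, metis)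
  then show "transpose (phase_jacobian \<Phi> z) ** J_matrix ** phase_jacobian \<Phi> z = J_matrix"
    by (rule symplectic_matrixI[OF phase_jacobian_stack[OF D]])
qed

end
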